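(* Let $f(x) = 1 - x + \frac{x^2}{2!} - \frac{x^3}{3!} + \sum_{k \text{ even},\, k \ge 6} \frac{x^k}{k!}$. Then the power series of the reciprocal $\frac{1}{f(x)}$ has all coefficients non-negative.
   Context: Power series are expanded about $0$ (formal power series in $x$). *)

theory Defs
  imports "HOL-Computational_Algebra.Formal_Power_Series"
begin

definition f_series :: "real fps" where
  "f_series = 1 - fps_X + fps_const (1 / fact 2) * fps_X ^ 2 - fps_const (1 / fact 3) * fps_X ^ 3
     + Abs_fps (\<lambda>k. if even k \<and> k \<ge> 6 then 1 / fact k else 0)"

end

theory Submission
  imports Defs
begin

text \<open>
  Put \<open>q = 1 + x + x\<^sup>2/2 + x\<^sup>3/6 + (x\<^sup>4/12) / (1 - 7x/12)\<close>: the reciprocal of \<open>f\<close> up to order 4,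
  continued by a geometric tail whose ratio lies slightly below the reciprocal of the smallest
  positive root of \<open>f\<close>. Then \<open>q f = 1 - s\<close> where \<open>s\<close> has non-negative coefficients, and hence
  \<open>1/f = q / (1 - s) = q (1 + s + s\<^sup>2 + \<dots>)\<close> has non-negative coefficients. For the sign of \<open>s\<close>,
  multiply by \<open>1 - 7x/12\<close>: the coefficients of \<open>(1 - 7x/12) q f\<close> of order at least 10
  are non-positive, because \<open>(1 - 7x/12) q = 1 + 5x/12 - x\<^sup>2/12 - x\<^sup>3/8 - x\<^sup>4/72\<close> and consecutive
  non-zero coefficients of \<open>f\<close> decay factorially.
\<close>

unbundle fps_syntax

text \<open>This replaces summing powers of \<open>1 - F\<close>: comparing coefficients in
  \<open>F * inverse F = 1\<close> makes each coefficient of the inverse a combination of earlier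
  ones with weights \<open>- F $ i\<close>.\<close>

lemma fps_inverse_nth_nonneg:
  fixes F :: "'a::linordered_field fps"
  assumes F0: "F $ 0 = 1" and F_le: "\<And>n. n > 0 \<Longrightarrow> F $ n \<le> 0"
  shows "inverse F $ n \<ge> 0"
proof (induction n rule: less_induct)
  case (less n)
  show ?case
  proof (cases "n = 0")
    case True
    then show ?thesis using F0 by simp
  next
    case False
    have "F * inverse F = 1" using F0 by (simp add: inverse_mult_eq_1')
    then have "(F * inverse F) $ n = 0" using False by simp
    then have "(\<Sum>i = 0..n. F $ i * inverse F $ (n - i)) = 0" by (simp add: fps_mult_nth)
    then have "inverse F $ n = - (\<Sum>i = 1..n. F $ i * inverse F $ (n - i))"
      using F0 by (simp add: sum.atLeast_Suc_atMost)
    also have "\<dots> \<ge> 0"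
      using less.IH F_le by (intro iffD2[OF neg_0_le_iff_le] sum_nonpos mult_nonpos_nonneg) auto
    finally show ?thesis .
  qed
qed

lemma fps_inverse_nth_nonneg_if_mult:
  fixes f q :: "'a::linordered_field fps"
  assumes q: "\<And>n. q $ n \<ge> 0" and qf0: "(q * f) $ 0 = 1"
    and qf_le: "\<And>n. n > 0 \<Longrightarrow> (q * f) $ n \<le> 0"
  shows "inverse f $ n \<ge> 0"
proof -
  have "q $ 0 \<noteq> 0" using qf0 by auto
  then have "inverse f = q * inverse (q * f)"
    by (simp add: fps_inverse_mult mult.assoc [symmetric] inverse_mult_eq_1')
  then show ?thesis
    using q fps_inverse_nth_nonneg[OF qf0 qf_le]
    by (simp add: fps_mult_nth sum_nonneg)
qed

definition q_series :: "real fps" where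
  "q_series = Abs_fps (\<lambda>n. if n \<le> 1 then 1 else if n = 2 then 1/2 else if n = 3 then 1/6
     else 1/12 * (7/12) ^ (n - 4))"

definition p_series :: "real fps" where
  "p_series = 1 + fps_const (5/12) * fps_X ^ 1 - fps_const (1/12) * fps_X ^ 2
     - fps_const (1/8) * fps_X ^ 3 - fps_const (1/72) * fps_X ^ 4"

lemma q_series_nonneg: "q_series $ n \<ge> 0"
  by (simp add: q_series_def)

lemma f_series_nth:
  "f_series $ n = (if n = 0 then 1 else if n = 1 then -1 else if n = 2 then 1/2
     else if n = 3 then -1/6 else if even n \<and> n \<ge> 6 then 1 / fact n else 0)"
  by (auto simp: f_series_def fps_X_power_nth fact_numeral)

lemma q_series_mult: "(1 - fps_const (7/12) * fps_X) * q_series = p_series"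
proof (rule fps_ext)
  fix n
  \<comment> \<open>Beyond order 4 the geometric tail cancels; orders 0 to 4 are checked
    directly.\<close>
  have "(7/12) ^ (n - 4) = (7/12) * (7/12 :: real) ^ (n - 1 - 4)" if "n > 4"
  proof -
    have "n - 4 = Suc (n - 1 - 4)" using that by simp
    then show ?thesis by (metis power_Suc)
  qed
  moreover have "n = 0 \<or> n = 1 \<or> n = 2 \<or> n = 3 \<or> n = 4 \<or> n > 4" by arith
  ultimately show "((1 - fps_const (7/12) * fps_X) * q_series) $ n = p_series $ n"
    by (auto simp: q_series_def p_series_def left_diff_distrib mult.assoc fps_X_power_nth)
qed

lemma p_series_mult_f_series_nth:
  "(p_series * f_series) $ n = f_series $ n
     + 5/12 * (if n < 1 then 0 else f_series $ (n - 1))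
     - 1/12 * (if n < 2 then 0 else f_series $ (n - 2))
     - 1/8 * (if n < 3 then 0 else f_series $ (n - 3))
     - 1/72 * (if n < 4 then 0 else f_series $ (n - 4))"
  by (simp only: p_series_def left_diff_distrib distrib_right mult.assoc fps_add_nth fps_sub_nth
      fps_mult_left_const_nth fps_X_power_mult_nth mult_1_left)

text \<open>From order 10 on, the indices from \<open>n - 4\<close> to \<open>n\<close> are all at
  least 6, beyond the irregular initial terms of \<open>f_series\<close>, so parity leaves a single
  positive term.\<close>

lemma p_series_mult_f_series_nth_nonpos:
  assumes "n \<ge> 10"
  shows "(p_series * f_series) $ n \<le> 0"
proof -
  \<comment> \<open>The factor 12 is what even \<open>n\<close> requires, to absorb
    \<open>f_series $ n\<close> into 1/12 of \<open>f_series $ (n - 2)\<close>. For odd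
    \<open>n\<close> it is ample: 5/12 against 12/8.\<close>
  have fact_ratio: "12 / fact (k + 2) \<le> (1 / fact k :: real)" if "k \<ge> 6" for k
  proof -
    have "12 \<le> (k + 2) * (k + 1)"
      using mult_mono[of 8 "k + 2" 7 "k + 1"] that by simp
    then have "12 \<le> real ((k + 2) * (k + 1))" by (metis of_nat_le_iff of_nat_numeral)
    then have "12 * fact k \<le> real ((k + 2) * (k + 1)) * fact k"
      by (rule mult_right_mono) simp
    also have "\<dots> = fact (k + 2)" by (simp add: algebra_simps)
    finally show ?thesis by (simp add: divide_simps del: fact_Suc)
  qed
  have f_nth: "f_series $ k = (if even k then 1 / fact k else 0)" if "k \<ge> 6" for k
    using that by (simp add: f_series_nth)
  have pf_nth: "(p_series * f_series) $ n = f_series $ n + 5/12 * f_series $ (n - 1)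
      - 1/12 * f_series $ (n - 2) - 1/8 * f_series $ (n - 3) - 1/72 * f_series $ (n - 4)"
    using assms by (simp add: p_series_mult_f_series_nth)
  have ge: "n \<ge> 6" "n - 1 \<ge> 6" "n - 2 \<ge> 6" "n - 3 \<ge> 6" "n - 4 \<ge> 6"
    using assms by simp_all
  have f_ratio: "12 * f_series $ (k + 2) \<le> f_series $ k" if "k \<ge> 6" for k
    using fact_ratio[OF that] f_nth[OF that] f_nth[of "k + 2"] that
    by (simp del: fact_Suc add_2_eq_Suc')
  show ?thesis
  proof (cases "even n")
    case True
    have "n - 2 + 2 = n" using assms by simp
    then have "12 * f_series $ n \<le> f_series $ (n - 2)"
      using f_ratio[OF ge(3)] by metis
    moreover have "f_series $ n \<ge> 0" "f_series $ (n - 4) \<ge> 0"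
      using ge(1,5)[THEN f_nth] by simp_all
    moreover have "f_series $ (n - 1) = 0" "f_series $ (n - 3) = 0"
      using ge(2,4)[THEN f_nth] True assms by simp_all
    ultimately show ?thesis unfolding pf_nth by linarith
  next
    case False
    have "n - 3 + 2 = n - 1" using assms by simp
    then have "12 * f_series $ (n - 1) \<le> f_series $ (n - 3)"
      using f_ratio[OF ge(4)] by metis
    moreover have "f_series $ (n - 1) \<ge> 0"
      using ge(2)[THEN f_nth] by simp
    moreover have "f_series $ n = 0" "f_series $ (n - 2) = 0" "f_series $ (n - 4) = 0"
      using ge(1,3,5)[THEN f_nth] False assms by simp_all
    ultimately show ?thesis unfolding pf_nth by linarith
  qed
qed

text \<open>As 7/12 is positive, a non-positive coefficient is inherited by the next order wherever
  \<open>p_series * f_series\<close> is non-positive.\<close>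

lemma q_series_mult_f_series_nth:
  assumes "n > 0"
  shows "(q_series * f_series) $ n
     = 7/12 * (q_series * f_series) $ (n - 1) + (p_series * f_series) $ n"
  using assms by (simp add: q_series_mult [symmetric] left_diff_distrib mult.assoc)

lemma q_series_mult_f_series_nth_0: "(q_series * f_series) $ 0 = 1"
  by (simp add: q_series_def f_series_nth)

lemma q_series_mult_f_series_nth_nonpos:
  "n > 0 \<Longrightarrow> (q_series * f_series) $ n \<le> 0"
proof (induction n)
  case (Suc n)
  show ?case
  proof (cases "n < 9")
    \<comment> \<open>Explicit values are needed here: \<open>p_series * f_series\<close> has
      positive coefficients 11/720 and 5/1728 at orders 6 and 7. The margin is thin: at order 7 the
      coefficient of \<open>q_series * f_series\<close> is -1/103680.\<close>
    case True
    then have "Suc n \<in> {1, 2, 3, 4, 5, 6, 7, 8, 9}" by auto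
    then show ?thesis
      by (elim insertE emptyE)
        (simp_all add: q_series_mult_f_series_nth q_series_mult_f_series_nth_0
          p_series_mult_f_series_nth f_series_nth fact_numeral del: fps_mult_nth_0 fps_mult_nth_1 fps_mult_nth_1')
  next
    case False
    then show ?thesis
      using Suc.IH p_series_mult_f_series_nth_nonpos[of "Suc n"]
        q_series_mult_f_series_nth[of "Suc n"] by simp
  qed
qed simp

theorem theorem5p4:
  shows "\<forall>n. fps_nth (inverse f_series) n \<ge> 0"
  using fps_inverse_nth_nonneg_if_mult[OF q_series_nonneg q_series_mult_f_series_nth_0
      q_series_mult_f_series_nth_nonpos] by blast

end
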